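(* Let $f\in \mathbb{Z}[t]$ be a quadratic polynomial. Then there is a constant $c>0$ such that there are polynomials $g\in \mathbb{Z}[t]$ of arbitrarily large odd degree $k$ for which $f(g(t))$ factors as a product of polynomials of degree at most $ck/\sqrt{\log\log k}$. Consequently, $f$ admits polysmoothness $\varepsilon$ for every $\varepsilon>0$.
   Context: A polynomial $f\in\mathbb{Z}[t]$ of positive degree admits polysmoothness $\theta$ (for a real $\theta\ge 0$) if there exists a non-constant polynomial $g\in\mathbb{Z}[t]$ such that every irreducible factor of $f(g(t))$ has degree at most $\theta\,(\deg f)(\deg g)$. *)

theory Defs
  imports Complex_Main "HOL-Computational_Algebra.Polynomial"
begin

definition admits_polysmoothness :: "int poly \<Rightarrow> real \<Rightarrow> bool" where
  "admits_polysmoothness f \<theta> \<longleftrightarrow>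
     (\<exists>g::int poly. degree g > 0 \<and>
        (\<forall>h::int poly. irreducible h \<and> h dvd pcompose f g \<longrightarrow>
           real (degree h) \<le> \<theta> * real (degree f) * real (degree g)))"

end

theory Submission
  imports Defs "HOL-Computational_Algebra.Polynomial_Factorial" "HOL-Analysis.Harmonic_Numbers"
    "HOL-Number_Theory.Totient"
begin

text \<open>Let \<open>f = a t\<^sup>2 + b t + c\<close> have discriminant \<open>D \<noteq> 0\<close>, let \<open>\<rho>\<close> and \<open>\<rho>'\<close> be the roots of
  \<open>X\<^sup>2 + b X + a c\<close>, and put \<open>y = 2 a D\<close>, \<open>\<beta> = 1 + y \<rho>\<close>, \<open>\<beta>' = 1 + y \<rho>'\<close> and \<open>\<beta> ^ k = u + y v \<rho>\<close>
  with integers \<open>u, v\<close>. If \<open>w\<close> is a linear polynomial with \<open>w ^ k \<equiv> u (mod a y v)\<close>, then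
  \<open>g = (w ^ k - u) / (a y v)\<close> is integral and
  \<open>a y\<^sup>2 v\<^sup>2 f(g) = (w ^ k - \<beta> ^ k) (w ^ k - \<beta>' ^ k)\<close>. Grouping the linear factors \<open>w - \<zeta> \<beta>\<close> and
  \<open>w - \<zeta> \<beta>'\<close> by the order \<open>d\<close> of the root of unity \<open>\<zeta>\<close> splits the right hand side into integral
  factors of degree \<open>2 \<phi>(d) \<le> 2 \<phi>(k)\<close>.

  The congruence is solvable whenever \<open>k\<close> is prime to \<open>y\<close>: modulo \<open>a y\<close> one has \<open>u \<equiv> 1\<close>, and modulo
  \<open>v\<close>, which is prime to \<open>u y\<close>, the norm equation gives \<open>u\<^sup>2 \<equiv> (\<beta> \<beta>') ^ k\<close>, which makes \<open>u\<close> a \<open>k\<close>-th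
  power residue because \<open>k\<close> is odd. Taking for \<open>k\<close> the product of the primes up to a bound that do
  not divide \<open>y\<close> gives \<open>\<phi>(k) = O(k / log log k)\<close>. If \<open>D = 0\<close>, then \<open>4 a f(g) = (2 a g + b)\<^sup>2\<close>, and
  \<open>2 a g + b\<close> can be made a constant times the \<open>k\<close>-th power of a linear polynomial.\<close>

subsection \<open>Cyclotomic factors of \<open>X ^ k - \<beta> ^ k\<close>\<close>

abbreviation cpoly :: "int poly \<Rightarrow> complex poly" where
  "cpoly \<equiv> map_poly of_int"

lemma cpoly_add: "cpoly (p + q) = cpoly p + cpoly q"
  by (intro poly_eqI) (simp add: coeff_map_poly)

lemma cpoly_mult: "cpoly (p * q) = cpoly p * cpoly q"
  by (intro poly_eqI) (simp add: coeff_map_poly coeff_mult)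

lemma cpoly_prod: "cpoly (\<Prod>i\<in>A. f i) = (\<Prod>i\<in>A. cpoly (f i))"
  by (induction A rule: infinite_finite_induct) (simp_all add: cpoly_mult)

lemma degree_cpoly: "degree (cpoly p) = degree p"
  by (rule degree_map_poly) simp

lemma lead_coeff_cpoly: "lead_coeff (cpoly p) = of_int (lead_coeff p)"
  by (simp add: degree_cpoly coeff_map_poly)

lemma cpoly_inject: "cpoly p = cpoly q \<longleftrightarrow> p = q"
  by (auto simp: poly_eq_iff coeff_map_poly)

text \<open>Pseudo-division by the monic \<open>q\<close> is genuine division
  \<open>p = q * s + r\<close>. Over the complex numbers \<open>q * (B - s) = r\<close>, and since
  \<open>r\<close> has smaller degree than \<open>q\<close> this forces
  \<open>B = s\<close>.\<close>

lemma monic_quotient_integral: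
  assumes "cpoly p = cpoly q * B" and "lead_coeff q = 1"
  shows "\<exists>s. B = cpoly s"
proof -
  obtain s r where sr: "pseudo_divmod p q = (s, r)" by (cases "pseudo_divmod p q")
  have "q \<noteq> 0" using assms(2) by auto
  have eq: "p = q * s + r" and deg: "r = 0 \<or> degree r < degree q"
    using pseudo_divmod[OF \<open>q \<noteq> 0\<close> sr] assms(2) by auto
  have *: "cpoly q * (B - cpoly s) = cpoly r"
    using assms(1) by (simp add: eq cpoly_add cpoly_mult algebra_simps)
  have "B - cpoly s = 0"
  proof (rule ccontr)
    assume nz: "B - cpoly s \<noteq> 0"
    have q0: "cpoly q \<noteq> 0" using \<open>q \<noteq> 0\<close> cpoly_inject[of q 0] by simp
    have "degree r = degree q + degree (B - cpoly s)"
      using degree_mult_eq[OF q0 nz] by (simp add: * degree_cpoly)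
    moreover have "r \<noteq> 0" using * nz q0 by auto
    ultimately show False using deg by simp
  qed
  then show ?thesis by auto
qed

text \<open>For \<open>d > 0\<close> and \<open>\<beta> \<noteq> 0\<close> this is
  \<open>\<beta> ^ totient d * Phi_d(X / \<beta>)\<close> with Phi_d the cyclotomic polynomial; the
  product form stays monic for \<open>\<beta> = 0\<close>. It is complex because only the product
  over two conjugates is going to be integral.\<close>

definition twisted_cyclotomic :: "nat \<Rightarrow> complex \<Rightarrow> complex poly" where
  "twisted_cyclotomic d \<beta> = (\<Prod>j\<in>totatives d. [:- (cis (2 * pi * real j / real d) * \<beta>), 1:])"

lemma degree_twisted_cyclotomic: "degree (twisted_cyclotomic d \<beta>) = totient d"
  unfolding twisted_cyclotomic_def totient_def by (subst degree_prod_sum_eq) auto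

lemma lead_coeff_twisted_cyclotomic: "lead_coeff (twisted_cyclotomic d \<beta>) = 1"
  unfolding twisted_cyclotomic_def by (subst lead_coeff_prod) simp

lemma prod_roots_of_unity:
  assumes "k > 0"
  shows "(\<Prod>j\<in>{0<..k}. [:- (cis (2 * pi * real j / real k) * \<beta>), 1:]) = monom 1 k - [:\<beta> ^ k:]"
    (is "prod ?F _ = _")
proof -
  define \<zeta> where "\<zeta> = (\<lambda>j. cis (2 * pi * real j / real k))"
  \<comment> \<open>The range \<open>{0<..k}\<close> fits \<open>totatives\<close>, while roots of
    unity are enumerated by \<open>{..<k}\<close>; the indices \<open>k\<close> and 0 give the same
    factor.\<close>
  have "(\<Prod>j\<in>{0<..k}. ?F j) = (\<Prod>j<k. ?F j)"
  proof -
    have *: "{0<..k} = insert k {0<..<k}" "{..<k} = insert 0 {0<..<k}" using assms by auto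
    have "?F k = ?F 0" using assms by simp
    then show ?thesis unfolding * by (subst (1 2) prod.insert) auto
  qed
  also have "\<dots> = monom 1 k - [:\<beta> ^ k:]"
  proof (cases "\<beta> = 0")
    case True
    then show ?thesis using assms by (simp add: zero_power monom_altdef)
  next
    case False
    \<comment> \<open>Both sides have degree at most \<open>k\<close> and the same coefficient at
      \<open>k\<close>, and they agree at the \<open>k\<close> distinct points
      \<open>\<zeta> j * \<beta>\<close>.\<close>
    show ?thesis
    proof (rule poly_eqI_degree_lead_coeff[where n = k and A = "(\<lambda>j. \<zeta> j * \<beta>) ` {..<k}"])
      have bij: "bij_betw \<zeta> {..<k} {z. z ^ k = 1}"
        unfolding \<zeta>_def by (rule Complex.bij_betw_roots_unity[OF assms])
      have "inj_on (\<lambda>j. \<zeta> j * \<beta>) {..<k}"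
        using bij False unfolding bij_betw_def inj_on_def by auto
      then show "k \<le> card ((\<lambda>j. \<zeta> j * \<beta>) ` {..<k})" by (simp add: card_image)
      have deg: "degree (\<Prod>j<k. ?F j) = k" by (subst degree_prod_sum_eq) auto
      then show "degree (\<Prod>j<k. ?F j) \<le> k" by simp
      have "lead_coeff (\<Prod>j<k. ?F j) = 1" by (subst lead_coeff_prod) simp
      then show "poly.coeff (\<Prod>j<k. ?F j) k = poly.coeff (monom 1 k - [:\<beta> ^ k:]) k"
        using assms deg by (simp add: coeff_pCons split: nat.splits)
      show "degree (monom 1 k - [:\<beta> ^ k:]) \<le> k"
        by (intro degree_diff_le) (simp_all add: degree_monom_le)
      fix z assume "z \<in> (\<lambda>j. \<zeta> j * \<beta>) ` {..<k}"
      then obtain j where j: "j < k" "z = \<zeta> j * \<beta>" by auto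
      then have "\<zeta> j ^ k = 1" using bij unfolding bij_betw_def by auto
      moreover have "poly (\<Prod>j<k. ?F j) z = 0"
        unfolding poly_prod using j by (intro prod_zero) (auto simp: \<zeta>_def)
      ultimately show "poly (\<Prod>j<k. ?F j) z = poly (monom 1 k - [:\<beta> ^ k:]) z"
        by (simp add: j poly_monom power_mult_distrib)
    qed
  qed
  finally show ?thesis .
qed

text \<open>The indices \<open>j\<close> with \<open>gcd j k = d\<close> are the multiples by
  \<open>d\<close> of the totatives of \<open>k div d\<close>; they contribute the primitive roots
  of order \<open>k div d\<close>.\<close>

lemma prod_twisted_cyclotomic:
  assumes "k > 0"
  shows "(\<Prod>d | d dvd k. twisted_cyclotomic d \<beta>) = monom 1 k - [:\<beta> ^ k:]"
proof -
  define F where "F = (\<lambda>j. [:- (cis (2 * pi * real j / real k) * \<beta>), 1:])"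
  define A where "A = (\<lambda>d. {j\<in>{0<..k}. gcd j k = d})"
  have *: "prod F (A d) = twisted_cyclotomic (k div d) \<beta>" if "d dvd k" for d
  proof -
    from that assms have "d > 0" "real k / real d = real (k div d)"
      by (auto intro: dvd_pos_nat simp: real_of_nat_div)
    then have "F (j * d) = [:- (cis (2 * pi * real j / real (k div d)) * \<beta>), 1:]" for j
      using assms by (simp add: F_def mult.assoc flip: \<open>real k / real d = _\<close>)
    then show ?thesis unfolding A_def twisted_cyclotomic_def
      using prod.reindex_bij_betw[OF bij_betw_totatives_gcd_eq[OF that assms], of F] by simp
  qed
  have "monom 1 k - [:\<beta> ^ k:] = prod F {0<..k}"
    unfolding F_def by (rule prod_roots_of_unity[OF assms, symmetric])
  also have "{0<..k} = (\<Union>d\<in>{d. d dvd k}. A d)" by (auto simp: A_def)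
  also have "prod F \<dots> = (\<Prod>d | d dvd k. prod F (A d))"
    using assms by (intro prod.UNION_disjoint) (auto simp: A_def)
  also have "\<dots> = (\<Prod>d | d dvd k. twisted_cyclotomic (k div d) \<beta>)"
    by (intro prod.cong refl *) auto
  also have "\<dots> = (\<Prod>d | d dvd k. twisted_cyclotomic d \<beta>)" using assms
    by (intro prod.reindex_bij_witness[of _ "(div) k" "(div) k"]) (auto elim: dvdE)
  finally show ?thesis ..
qed

text \<open>As roots of \<open>X^2 - T X + N\<close>, both numbers have powers obeying one integral
  recurrence of order two.\<close>

lemma power_sum_integral:
  fixes \<beta> \<beta>' :: complex
  assumes "\<beta> + \<beta>' = of_int T" "\<beta> * \<beta>' = of_int N"
  shows "\<exists>S::int. \<beta> ^ n + \<beta>' ^ n = of_int S"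
proof (induction n rule: less_induct)
  case (less n)
  consider "n = 0" | "n = 1" | m where "n = Suc (Suc m)"
    by (metis One_nat_def old.nat.exhaust)
  then show ?case
  proof cases
    case 1
    then have "\<beta> ^ n + \<beta>' ^ n = of_int 2" by simp
    then show ?thesis ..
  next
    case 2
    then show ?thesis using assms(1) by auto
  next
    case 3
    obtain S1 S0 where S: "\<beta> ^ Suc m + \<beta>' ^ Suc m = of_int S1" "\<beta> ^ m + \<beta>' ^ m = of_int S0"
      using less[of "Suc m"] less[of m] 3 by auto
    have "\<beta> ^ n + \<beta>' ^ n = (\<beta> + \<beta>') * (\<beta> ^ Suc m + \<beta>' ^ Suc m) - (\<beta> * \<beta>') * (\<beta> ^ m + \<beta>' ^ m)"
      by (simp add: 3 algebra_simps)
    also have "\<dots> = of_int (T * S1 - N * S0)" unfolding S assms by simp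
    finally show ?thesis ..
  qed
qed

text \<open>Induction over divisors takes the place of Galois theory, so rational
  \<open>\<beta>\<close> needs no separate case. The product over all \<open>e dvd d\<close> is
  \<open>X^(2d) - S X^d + N^d\<close>; its factors with \<open>e < d\<close> are integral by
  induction and monic, hence so is the quotient integral.\<close>

lemma twisted_cyclotomic_norm_integral:
  fixes \<beta> \<beta>' :: complex
  assumes "\<beta> + \<beta>' = of_int T" "\<beta> * \<beta>' = of_int N" and "d > 0"
  shows "\<exists>s. twisted_cyclotomic d \<beta> * twisted_cyclotomic d \<beta>' = cpoly s"
  using \<open>d > 0\<close>
proof (induction d rule: less_induct)
  case (less d)
  let ?P = "\<lambda>d. twisted_cyclotomic d \<beta> * twisted_cyclotomic d \<beta>'"
  let ?E = "{e. e dvd d} - {d}"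
  have fin: "finite {e. e dvd d}" using less.prems by simp
  have "\<forall>e\<in>?E. \<exists>s. ?P e = cpoly s"
  proof
    fix e assume "e \<in> ?E"
    then have "e < d" "0 < e" using less.prems dvd_imp_le[of e d] dvd_pos_nat[of d e] by auto
    then show "\<exists>s. ?P e = cpoly s" by (rule less.IH)
  qed
  then obtain s where s: "\<And>e. e \<in> ?E \<Longrightarrow> ?P e = cpoly (s e)" by metis
  obtain S where S: "\<beta> ^ d + \<beta>' ^ d = of_int S" using power_sum_integral[OF assms(1,2)] by blast
  have "(monom 1 d - [:\<beta> ^ d:]) * (monom 1 d - [:\<beta>' ^ d:])
      = monom 1 (2 * d) - smult (\<beta> ^ d + \<beta>' ^ d) (monom 1 d) + [:(\<beta> * \<beta>') ^ d:]"
    unfolding mult_2 by (simp add: algebra_simps mult_monom power_mult_distrib smult_add_left)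
  also have "\<dots> = cpoly (monom 1 (2 * d) - monom S d + [:N ^ d:])"
    by (intro poly_eqI) (simp add: S assms(2) coeff_map_poly coeff_pCons split: nat.splits)
  finally have "cpoly (monom 1 (2 * d) - monom S d + [:N ^ d:])
      = (\<Prod>e | e dvd d. twisted_cyclotomic e \<beta>) * (\<Prod>e | e dvd d. twisted_cyclotomic e \<beta>')"
    using less.prems by (simp add: prod_twisted_cyclotomic)
  also have "\<dots> = (\<Prod>e | e dvd d. ?P e)" by (simp add: prod.distrib)
  also have "\<dots> = ?P d * (\<Prod>e\<in>?E. ?P e)" by (rule prod.remove[OF fin]) simp
  also have "(\<Prod>e\<in>?E. ?P e) = cpoly (\<Prod>e\<in>?E. s e)" by (simp add: cpoly_prod s)
  finally have eq: "cpoly (monom 1 (2 * d) - monom S d + [:N ^ d:]) = cpoly (\<Prod>e\<in>?E. s e) * ?P d"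
    by (simp only: mult.commute)
  have "lead_coeff (s e) = 1" if "e \<in> ?E" for e
  proof -
    have "lead_coeff (cpoly (s e)) = 1"
      unfolding s[OF that, symmetric] by (simp only: lead_coeff_mult lead_coeff_twisted_cyclotomic mult_1)
    then show ?thesis unfolding lead_coeff_cpoly by simp
  qed
  then have "lead_coeff (\<Prod>e\<in>?E. s e) = 1" by (simp only: lead_coeff_prod prod.neutral_const cong: prod.cong)
  from monic_quotient_integral[OF eq this] show ?case .
qed

lemma twisted_cyclotomic_factorization:
  fixes \<beta> \<beta>' :: complex
  assumes "\<beta> + \<beta>' = of_int T" "\<beta> * \<beta>' = of_int N" "\<beta> ^ k + \<beta>' ^ k = of_int S" and "k > 0"
  shows "\<exists>\<Psi>. monom 1 (2 * k) - monom S k + [:N ^ k:] = (\<Prod>d | d dvd k. \<Psi> d)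
           \<and> (\<forall>d. d dvd k \<longrightarrow> \<Psi> d \<noteq> 0 \<and> degree (\<Psi> d) = 2 * totient d)"
proof -
  let ?P = "\<lambda>d. twisted_cyclotomic d \<beta> * twisted_cyclotomic d \<beta>'"
  have "\<forall>d\<in>{d. d dvd k}. \<exists>s. ?P d = cpoly s"
    using twisted_cyclotomic_norm_integral[OF assms(1,2)] assms(4) dvd_pos_nat by blast
  then obtain \<Psi> where s: "\<And>d. d dvd k \<Longrightarrow> ?P d = cpoly (\<Psi> d)" by (metis mem_Collect_eq)
  have "cpoly (monom 1 (2 * k) - monom S k + [:N ^ k:])
      = monom 1 (2 * k) - smult (\<beta> ^ k + \<beta>' ^ k) (monom 1 k) + [:(\<beta> * \<beta>') ^ k:]"
    by (intro poly_eqI) (simp add: assms coeff_map_poly coeff_pCons split: nat.splits)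
  also have "\<dots> = (monom 1 k - [:\<beta> ^ k:]) * (monom 1 k - [:\<beta>' ^ k:])"
    unfolding mult_2 by (simp add: algebra_simps mult_monom power_mult_distrib smult_add_left)
  also have "\<dots> = (\<Prod>d | d dvd k. ?P d)"
    using assms(4) by (simp add: prod.distrib prod_twisted_cyclotomic)
  also have "\<dots> = cpoly (\<Prod>d | d dvd k. \<Psi> d)" by (simp add: cpoly_prod s)
  finally have "monom 1 (2 * k) - monom S k + [:N ^ k:] = (\<Prod>d | d dvd k. \<Psi> d)"
    by (simp only: cpoly_inject)
  moreover have "\<Psi> d \<noteq> 0 \<and> degree (\<Psi> d) = 2 * totient d" if "d dvd k" for d
  proof -
    have nz: "twisted_cyclotomic d \<gamma> \<noteq> 0" for \<gamma> using lead_coeff_twisted_cyclotomic[of d \<gamma>] by auto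
    then have "cpoly (\<Psi> d) \<noteq> 0" using s[OF that] by (metis mult_eq_0_iff)
    moreover have "degree (cpoly (\<Psi> d)) = 2 * totient d"
      unfolding s[OF that, symmetric] using nz by (simp add: degree_mult_eq degree_twisted_cyclotomic)
    ultimately show ?thesis by (auto simp: degree_cpoly)
  qed
  ultimately show ?thesis by blast
qed

subsection \<open>Integers with small totient\<close>

text \<open>The right hand side is the sum of the reciprocals of all \<open>P\<close>-smooth numbers.\<close>

lemma sum_inverse_smooth_le:
  fixes P :: "nat set"
  assumes "finite P" and "\<And>p. p \<in> P \<Longrightarrow> prime p"
  shows "(\<Sum>m | m \<in> {1..n} \<and> prime_factors m \<subseteq> P. 1 / real m) \<le> (\<Prod>p\<in>P. 1 / (1 - 1 / real p))"
  using assms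
proof (induction P rule: finite_induct)
  case empty
  have "{m. m \<in> {1..n} \<and> prime_factors m \<subseteq> {}} \<subseteq> {1}"
    by (auto simp: prime_factorization_empty_iff)
  then have "(\<Sum>m | m \<in> {1..n} \<and> prime_factors m \<subseteq> {}. 1 / real m) \<le> (\<Sum>m\<in>{1}. 1 / real m)"
    by (intro sum_mono2) auto
  then show ?case by simp
next
  case (insert p P)
  define S where "S = (\<lambda>P. {m. m \<in> {1..n} \<and> prime_factors m \<subseteq> P})"
  have fin: "finite (S P)" for P by (simp add: S_def)
  have p: "prime p" "p > 1" using insert.prems prime_gt_1_nat by auto
  \<comment> \<open>Strip the full power of \<open>p\<close> from \<open>m\<close>, leaving a
    cofactor with prime factors in \<open>P\<close>. The crude bound \<open>e \<le> n\<close> makes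
    the exponents a finite range, to be summed as a geometric series.\<close>
  have sub: "S (insert p P) \<subseteq> (\<lambda>(e, m). p ^ e * m) ` ({..n} \<times> S P)"
  proof
    fix m assume m: "m \<in> S (insert p P)"
    then have m0: "m > 0" "m \<le> n" by (auto simp: S_def)
    define e where "e = multiplicity p m"
    obtain m' where m': "m = p ^ e * m'" "\<not> p dvd m'"
      using multiplicity_decompose'[of m p] m0 p unfolding e_def by (metis not_prime_unit not_gr_zero)
    have "m' > 0" "m' dvd m" using m' m0 by auto
    then have "m' \<le> n" using m0 dvd_imp_le[of m' m] by simp
    moreover have "prime_factors m' \<subseteq> P"
    proof
      fix q assume q: "q \<in> prime_factors m'"
      then have "q dvd m'" by auto
      then have "q \<noteq> p" using m'(2) by auto
      moreover have "q \<in> prime_factors m"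
        using dvd_prime_factors[OF _ \<open>m' dvd m\<close>] m0 q by auto
      ultimately show "q \<in> P" using m by (auto simp: S_def)
    qed
    moreover have "e \<le> n"
    proof -
      have "e < p ^ e" using p(2) by (intro power_gt_expt) simp
      also have "\<dots> \<le> m" using m0 m'(1) by (intro dvd_imp_le) auto
      finally show ?thesis using m0 by simp
    qed
    ultimately show "m \<in> (\<lambda>(e, m). p ^ e * m) ` ({..n} \<times> S P)"
      using \<open>m' > 0\<close> m'(1) by (intro image_eqI[of _ _ "(e, m')"]) (auto simp: S_def)
  qed
  have gp: "(\<Sum>e\<le>n. (1 / real p) ^ e) \<le> 1 / (1 - 1 / real p)"
  proof -
    have "(1 - 1 / real p) * (\<Sum>e\<le>n. (1 / real p) ^ e) \<le> 1"
      unfolding sum_gp_basic by simp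
    then show ?thesis using p(2) by (simp add: field_simps)
  qed
  have "(\<Sum>m\<in>S (insert p P). 1 / real m)
      \<le> (\<Sum>m\<in>(\<lambda>(e, m). p ^ e * m) ` ({..n} \<times> S P). 1 / real m)"
    using fin by (intro sum_mono2 sub) auto
  also have "\<dots> \<le> (\<Sum>x\<in>{..n} \<times> S P. 1 / real (case x of (e, m) \<Rightarrow> p ^ e * m))"
    using sum_image_le[of "{..n} \<times> S P" "\<lambda>m. 1 / real m" "\<lambda>(e, m). p ^ e * m"] fin by (simp add: o_def)
  also have "\<dots> = (\<Sum>e\<le>n. (1 / real p) ^ e) * (\<Sum>m\<in>S P. 1 / real m)"
    by (simp add: sum_product sum.cartesian_product power_divide case_prod_unfold)
  also have "\<dots> \<le> 1 / (1 - 1 / real p) * (\<Prod>p\<in>P. 1 / (1 - 1 / real p))"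
    using insert p(2) gp unfolding S_def by (intro mult_mono) (auto intro!: sum_nonneg)
  also have "\<dots> = (\<Prod>p\<in>insert p P. 1 / (1 - 1 / real p))" using insert by simp
  finally show ?case unfolding S_def .
qed

text \<open>A weak Mertens estimate: every \<open>m \<le> n\<close> has only prime factors up to
  \<open>n\<close>, so the harmonic sum, which is at least \<open>ln (n + 1)\<close>, is bounded by
  the Euler product.\<close>

lemma prod_primes_le_inverse_ln:
  assumes "n > 0"
  shows "(\<Prod>p | prime p \<and> p \<le> n. 1 - 1 / real p) \<le> 1 / ln (real n + 1)"
proof -
  let ?P = "{p. prime p \<and> p \<le> n}"
  have pos: "0 < (\<Prod>p\<in>?P. 1 - 1 / real p)"
    by (intro prod_pos) (auto dest: prime_gt_1_nat)
  have *: "{m. m \<in> {1..n} \<and> prime_factors m \<subseteq> ?P} = {1..n}"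
  proof (intro equalityI subsetI CollectI conjI)
    fix m p assume "m \<in> {1..n}" "p \<in> prime_factors m"
    then show "prime p" "p \<le> n" by (auto simp: prime_factors_dvd dest!: dvd_imp_le)
  qed auto
  have "ln (real n + 1) \<le> (\<Sum>m=1..n. 1 / real m)"
    using ln_le_harm[of n] by (simp add: harm_def inverse_eq_divide)
  also have "\<dots> \<le> (\<Prod>p\<in>?P. 1 / (1 - 1 / real p))"
    by (rule sum_inverse_smooth_le[of ?P n, unfolded *]) auto
  also have "\<dots> = 1 / (\<Prod>p\<in>?P. 1 - 1 / real p)" by (simp only: prod_dividef prod.neutral_const)
  finally have "ln (real n + 1) \<le> 1 / (\<Prod>p\<in>?P. 1 - 1 / real p)" .
  moreover have "0 < ln (real n + 1)" using assms by simp
  ultimately show ?thesis using pos by (simp only: pos_le_divide_eq mult.commute)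
qed

text \<open>Take for \<open>k\<close> the product of the primes up to \<open>y\<close> not dividing
  \<open>M\<close>. Omitting the primes that divide \<open>M\<close> costs at most the factor
  \<open>M / totient M\<close>, and the 2 in \<open>?C\<close> comes from
  \<open>ln (ln k) \<le> 2 * ln y\<close>.\<close>

lemma totient_small_coprime:
  fixes M :: nat
  assumes "M > 0"
  shows "\<exists>C>0. \<forall>N. \<exists>k\<ge>N. coprime k M \<and> real (totient k) \<le> C * real k / ln (ln (real k))"
proof -
  let ?C = "2 * real M / real (totient M)"
  have "\<exists>k\<ge>N. coprime k M \<and> real (totient k) \<le> ?C * real k / ln (ln (real k))" for N
  proof -
  \<comment> \<open>Exceeding \<open>M\<close> puts \<open>y\<close> itself into \<open>K\<close>,
    so that \<open>N \<le> y \<le> k\<close>; the 16 is a generous margin keeping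
    \<open>ln (ln k)\<close> positive.\<close>
  obtain y where y: "prime y" "y > M + N + 16" using bigger_prime by blast
  define A where "A = {p. prime p \<and> p \<le> y}"
  define K where "K = {p\<in>A. \<not> p dvd M}"
  define k where "k = \<Prod>K"
  have fin: "finite A" "finite K" "K \<subseteq> A" by (auto simp: A_def K_def)
  have Kp: "prime p" if "p \<in> K" for p using that by (auto simp: K_def A_def)
  have "y \<in> K" using y assms by (auto simp: K_def A_def dest: dvd_imp_le)
  have k0: "k > 0" unfolding k_def using Kp by (auto intro!: prod_pos dest: prime_gt_0_nat)
  have yk: "y \<le> k"
    using k0 fin \<open>y \<in> K\<close> unfolding k_def by (intro dvd_imp_le) (auto intro: dvd_prodI)
  have cop: "coprime k M"
    unfolding k_def using Kp by (intro prod_coprime_left) (auto simp: K_def intro: prime_imp_coprime)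
  have "prime_factors k = K"
    unfolding k_def using fin(2) Kp by (subst prime_factors_prod) (auto simp: prime_prime_factors dest: prime_gt_0_nat)
  then have phi: "real (totient k) = real k * (\<Prod>p\<in>K. 1 - 1 / real p)"
    using totient_formula2[of k] by simp
  have fac: "0 < 1 - 1 / real p" "1 - 1 / real p \<le> 1" if "prime p" for p
    using prime_gt_1_nat[OF that] by auto
  have split: "(\<Prod>p\<in>A. 1 - 1 / real p) = (\<Prod>p\<in>K. 1 - 1 / real p) * (\<Prod>p\<in>A - K. 1 - 1 / real p)"
    using prod.subset_diff[OF fin(3,1)] by (simp add: mult.commute)
  have "real (totient M) = real M * (\<Prod>p\<in>prime_factors M. 1 - 1 / real p)"
    by (rule totient_formula2)
  \<comment> \<open>The primes in \<open>A - K\<close> all divide \<open>M\<close>, and dropping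
    further factors from (0, 1] only increases a product.\<close>
  also have "(\<Prod>p\<in>prime_factors M. 1 - 1 / real p) \<le> (\<Prod>p\<in>A - K. 1 - 1 / real p)"
  proof -
    have sub: "A - K \<subseteq> prime_factors M" using assms by (auto simp: A_def K_def prime_factors_dvd)
    have "(\<Prod>p\<in>prime_factors M. 1 - 1 / real p)
        = (\<Prod>p\<in>prime_factors M - (A - K). 1 - 1 / real p) * (\<Prod>p\<in>A - K. 1 - 1 / real p)"
      by (rule prod.subset_diff[OF sub]) simp
    also have "\<dots> \<le> 1 * (\<Prod>p\<in>A - K. 1 - 1 / real p)"
      using fac by (intro mult_right_mono prod_le_1 prod_nonneg) (auto simp: A_def divide_le_eq)
    finally show ?thesis by simp
  qed
  finally have M: "real (totient M) / real M \<le> (\<Prod>p\<in>A - K. 1 - 1 / real p)"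
    using assms by (simp add: field_simps)
  have "(\<Prod>p\<in>K. 1 - 1 / real p) * (real (totient M) / real M)
      \<le> (\<Prod>p\<in>K. 1 - 1 / real p) * (\<Prod>p\<in>A - K. 1 - 1 / real p)"
    using fac Kp by (intro mult_left_mono[OF M] prod_nonneg) (auto simp: less_imp_le)
  also have "\<dots> \<le> 1 / ln (real y + 1)"
    using prod_primes_le_inverse_ln[of y, folded A_def] y unfolding split by simp
  also have "\<dots> \<le> 1 / ln (real y)"
    using y by (intro divide_left_mono) auto
  finally have *: "(\<Prod>p\<in>K. 1 - 1 / real p) * (real (totient M) / real M) \<le> 1 / ln (real y)" .
  have "0 < ln (real y)" using y by simp
  then have "(\<Prod>p\<in>K. 1 - 1 / real p) \<le> real M / real (totient M) / ln (real y)"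
    using assms * by (simp add: field_simps)
  also have "\<dots> \<le> ?C / ln (ln (real k))"
  proof -
    have "real k \<le> real y ^ y"
    proof -
      \<comment> \<open>Being a product of distinct numbers up to \<open>y\<close>, \<open>k\<close>
        divides the factorial of \<open>y\<close>.\<close>
      have "k \<le> \<Prod>{1..y}"
        unfolding k_def
        by (intro dvd_imp_le prod_dvd_prod_subset prod_pos) (auto simp: K_def A_def Suc_le_eq dest: prime_gt_0_nat)
      also have "\<dots> \<le> y ^ y" using fact_le_power[where 'a = nat, of y] unfolding fact_prod by simp
      finally have "real k \<le> real (y ^ y)" by (rule of_nat_mono)
      then show ?thesis by simp
    qed
    then have "ln (real k) \<le> ln (real y ^ y)" using k0 y by (subst ln_le_cancel_iff) auto
    also have "\<dots> = real y * ln (real y)" using y by (simp add: ln_realpow)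
    also have "\<dots> \<le> real y * real y" using y ln_le_minus_one[of "real y"] by (intro mult_left_mono) auto
    finally have le: "ln (real k) \<le> real y ^ 2" by (simp add: power2_eq_square)
    have e: "1 < ln (real k)"
    proof -
      have "exp 1 < real k" using exp_le yk y by linarith
      then have "ln (exp 1) < ln (real k)" using k0 by (subst ln_less_cancel_iff) auto
      then show ?thesis by simp
    qed
    have "ln (ln (real k)) \<le> ln (real y ^ 2)" using le e y by (subst ln_le_cancel_iff) auto
    also have "\<dots> = 2 * ln (real y)" using y by (simp add: ln_realpow)
    finally have le2: "ln (ln (real k)) \<le> 2 * ln (real y)" .
    have "?C / (2 * ln (real y)) \<le> ?C / ln (ln (real k))"
      using le2 e y by (intro divide_left_mono) auto
    then show ?thesis by simp
  qed
  finally have "real k * (\<Prod>p\<in>K. 1 - 1 / real p) \<le> real k * (?C / ln (ln (real k)))"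
    by (intro mult_left_mono) auto
  then have "real (totient k) \<le> ?C * real k / ln (ln (real k))"
    unfolding phi by (simp add: mult_ac)
  then show ?thesis using yk y cop by (intro exI[of _ k]) auto
  qed
  moreover have "?C > 0" using assms by simp
  ultimately show ?thesis by blast
qed

subsection \<open>Powers in a quadratic order\<close>

text \<open>Multiplication by \<open>\<beta> = 1 + y * \<rho>\<close> acts on the coordinates
  \<open>(u, v)\<close> by an integral recurrence, and every claim follows along it; the same
  \<open>u\<close>, \<open>v\<close> serve both roots. Here \<open>N\<close> and \<open>T\<close>
  are norm and trace of \<open>\<beta>\<close>: from \<open>\<beta>^2 = T \<beta> - N\<close> one
  gets \<open>\<beta> ^ k = T ^ (k - 1) * \<beta>\<close> modulo \<open>N\<close>, and
  \<open>\<beta>\<close> has coordinates (1, 1).\<close>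

lemma power_coordinates:
  fixes b q y :: int and k :: nat
  defines "N \<equiv> 1 - b * y + q * y\<^sup>2" and "T \<equiv> 2 - b * y"
  shows "\<exists>u v. (\<forall>\<rho>::complex. \<rho>\<^sup>2 + of_int b * \<rho> + of_int q = 0 \<longrightarrow>
                  (1 + of_int y * \<rho>) ^ k = of_int u + of_int (y * v) * \<rho>)
           \<and> q * y dvd u - 1 \<and> y dvd v - int k
           \<and> (k > 0 \<longrightarrow> N dvd u - T ^ (k - 1) \<and> N dvd v - T ^ (k - 1))
           \<and> u\<^sup>2 - b * y * u * v + q * y\<^sup>2 * v\<^sup>2 = N ^ k"
proof (induction k)
  case 0
  show ?case by (intro exI[of _ 1] exI[of _ 0]) simp
next
  case (Suc k)
  obtain u v where
    pow: "\<And>\<rho>::complex. \<rho>\<^sup>2 + of_int b * \<rho> + of_int q = 0 \<Longrightarrow>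
            (1 + of_int y * \<rho>) ^ k = of_int u + of_int (y * v) * \<rho>"
    and u: "q * y dvd u - 1" and v: "y dvd v - int k"
    and N: "k > 0 \<Longrightarrow> N dvd u - T ^ (k - 1)" "k > 0 \<Longrightarrow> N dvd v - T ^ (k - 1)"
    and norm: "u\<^sup>2 - b * y * u * v + q * y\<^sup>2 * v\<^sup>2 = N ^ k"
    \<comment> \<open>The congruences modulo \<open>N\<close> begin at exponent 1, so that step
      needs the actual values at exponent 0.\<close>
    and k0: "k = 0 \<Longrightarrow> u = 1 \<and> v = 0"
  proof (cases "k = 0")
    case True
    show ?thesis by (rule that[of 1 0]) (simp_all add: True)
  next
    case False
    then show ?thesis using Suc that by auto
  qed
  let ?u = "u - q * y\<^sup>2 * v" and ?v = "v + u - b * y * v"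
  show ?case
  proof (rule exI[of _ ?u], rule exI[of _ ?v], intro conjI allI impI)
    fix \<rho> :: complex assume \<rho>: "\<rho>\<^sup>2 + of_int b * \<rho> + of_int q = 0"
    then have sq: "\<rho> * \<rho> = - of_int b * \<rho> - of_int q"
      by (simp add: power2_eq_square algebra_simps eq_neg_iff_add_eq_0)
    have "(1 + of_int y * \<rho>) ^ Suc k = (1 + of_int y * \<rho>) * (of_int u + of_int (y * v) * \<rho>)"
      by (simp add: pow[OF \<rho>])
    also have "\<dots> = of_int u + of_int (y * v + y * u) * \<rho> + of_int (y * y * v) * (\<rho> * \<rho>)"
      by (simp add: algebra_simps)
    also have "\<dots> = of_int ?u + of_int (y * ?v) * \<rho>"
      unfolding sq by (simp add: algebra_simps power2_eq_square)
    finally show "(1 + of_int y * \<rho>) ^ Suc k = of_int ?u + of_int (y * ?v) * \<rho>" .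
  next
    have "?u - 1 = (u - 1) - q * y * (y * v)" by (simp add: power2_eq_square)
    moreover have "q * y dvd (u - 1) - q * y * (y * v)" using u by (rule dvd_diff) simp
    ultimately show "q * y dvd ?u - 1" by (simp only:)
  next
    have "y dvd (v - int k) + (u - 1) - y * (b * v)"
      by (rule dvd_diff[OF dvd_add[OF v dvd_mult_right[OF u]]]) simp
    moreover have "?v - int (Suc k) = (v - int k) + (u - 1) - y * (b * v)" by simp
    ultimately show "y dvd ?v - int (Suc k)" by (simp only:)
  next
    show "N dvd ?u - T ^ (Suc k - 1)"
    proof (cases k)
      case 0
      then show ?thesis using k0 by simp
    next
      case (Suc j)
      \<comment> \<open>Modulo \<open>N\<close> both coordinates equal \<open>T ^ j\<close>, and
        \<open>1 - q * y\<^sup>2 = T - N\<close>.\<close>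
      have "?u - T ^ k = (u - T ^ j) - q * y\<^sup>2 * (v - T ^ j) - N * T ^ j"
        unfolding Suc N_def T_def by (simp add: algebra_simps)
      moreover have "N dvd (u - T ^ j) - q * y\<^sup>2 * (v - T ^ j) - N * T ^ j"
        using dvd_diff[OF dvd_diff[OF N(1) dvd_mult[OF N(2)]] dvd_triv_left] Suc by simp
      ultimately show ?thesis by (simp only: diff_Suc_1)
    qed
    show "N dvd ?v - T ^ (Suc k - 1)"
    proof (cases k)
      case 0
      then show ?thesis using k0 by simp
    next
      case (Suc j)
      have "?v - T ^ k = (u - T ^ j) + (1 - b * y) * (v - T ^ j)"
        unfolding Suc T_def by (simp add: algebra_simps)
      moreover have "N dvd (u - T ^ j) + (1 - b * y) * (v - T ^ j)"
        using dvd_add[OF N(1) dvd_mult[OF N(2)]] Suc by simp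
      ultimately show ?thesis by (simp only: diff_Suc_1)
    qed
  next
    have "?u\<^sup>2 - b * y * ?u * ?v + q * y\<^sup>2 * ?v\<^sup>2 = N * (u\<^sup>2 - b * y * u * v + q * y\<^sup>2 * v\<^sup>2)"
      unfolding N_def by (simp add: power2_eq_square algebra_simps)
    then show "?u\<^sup>2 - b * y * ?u * ?v + q * y\<^sup>2 * ?v\<^sup>2 = N ^ Suc k"
      unfolding norm by simp
  qed
qed

text \<open>Since \<open>k\<close> is odd, \<open>u = (u\<^sup>2) ^ ((k + 1) / 2) / u ^ k\<close>.\<close>

lemma exists_kth_root_mod:
  fixes u v N :: int
  assumes "odd k" and "coprime u v" and "[u\<^sup>2 = N ^ k] (mod v)"
  shows "\<exists>x. [x ^ k = u] (mod v)"
proof -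
  obtain h where h: "k + 1 = 2 * h" using \<open>odd k\<close> by (metis evenE odd_even_add odd_one)
  obtain z where z: "[u * z = 1] (mod v)" using cong_solve_coprime_int[OF assms(2)] by blast
  have "[u ^ k * (N ^ h * z) ^ k = (u * z) ^ k * (N ^ k) ^ h] (mod v)"
    by (simp add: power_mult_distrib mult_ac flip: power_mult)
  also have "[(u * z) ^ k * (N ^ k) ^ h = 1 ^ k * (u\<^sup>2) ^ h] (mod v)"
    by (intro cong_mult cong_pow z cong_sym[OF assms(3)])
  also have "1 ^ k * (u\<^sup>2) ^ h = u ^ k * u"
    by (simp flip: power_mult h)
  finally have "[(N ^ h * z) ^ k = u] (mod v)"
    using assms(2) by (simp add: cong_mult_lcancel coprime_power_left_iff)
  then show ?thesis ..
qed

text \<open>The final divisibility makes the coefficients of the later \<open>g\<close> integral. By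
  the Chinese remainder theorem it suffices to take \<open>w = 1\<close> modulo
  \<open>a * y\<close>, where \<open>u\<close> is 1, and a \<open>k\<close>-th root of
  \<open>u\<close> modulo \<open>v\<close>.\<close>

lemma integral_power_representation:
  fixes a b c y :: int
  assumes D: "b\<^sup>2 - 4 * (a * c) dvd y" and a: "a dvd y" and y: "even y"
    and k: "coprime (int k) y" "k > 0"
  shows "\<exists>u v w. (\<forall>\<rho>::complex. \<rho>\<^sup>2 + of_int b * \<rho> + of_int (a * c) = 0 \<longrightarrow>
                  (1 + of_int y * \<rho>) ^ k = of_int u + of_int (y * v) * \<rho>)
           \<and> u\<^sup>2 - b * y * u * v + a * c * y\<^sup>2 * v\<^sup>2 = (1 - b * y + a * c * y\<^sup>2) ^ k
           \<and> v \<noteq> 0 \<and> a * y * v dvd w ^ k - u"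
proof -
  define N T where "N = 1 - b * y + a * c * y\<^sup>2" and "T = 2 - b * y"
  obtain u v where
    pow: "\<And>\<rho>::complex. \<rho>\<^sup>2 + of_int b * \<rho> + of_int (a * c) = 0 \<Longrightarrow>
            (1 + of_int y * \<rho>) ^ k = of_int u + of_int (y * v) * \<rho>"
    and u: "a * c * y dvd u - 1" and v: "y dvd v - int k" and N: "N dvd u - T ^ (k - 1)"
    and norm: "u\<^sup>2 - b * y * u * v + a * c * y\<^sup>2 * v\<^sup>2 = N ^ k"
    using power_coordinates[of b "a * c" y k] k(2) unfolding N_def T_def by metis
  have "odd k" using k(1) y by (metis coprime_common_divisor even_of_nat odd_one)
  \<comment> \<open>Modulo \<open>y\<close> the coordinate \<open>v\<close> is just
    \<open>k\<close>.\<close>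
  have "coprime v y"
  proof -
    have "[v = int k] (mod y)" using v by (simp add: cong_iff_dvd_diff)
    then show ?thesis using k(1) by (metis cong_imp_coprime cong_sym)
  qed
  have "v \<noteq> 0"
  proof
    assume "v = 0"
    then have "is_unit y" using \<open>coprime v y\<close> by simp
    then show False using y by (metis dvd_trans odd_one)
  qed
  \<comment> \<open>Modulo a common prime divisor of \<open>u\<close> and \<open>v\<close> the norm \<open>N\<close> vanishes, so \<open>\<beta>\<^sup>2 = T \<beta>\<close> and
    \<open>\<beta> ^ k = T ^ (k - 1) * \<beta>\<close>; hence \<open>T\<close> and the discriminant \<open>T\<^sup>2 - 4 N\<close> vanish as well.\<close>
  have "coprime u v"
  proof (rule ccontr)
    assume "\<not> coprime u v"
    then have "\<not> is_unit (gcd u v)" by (simp add: coprime_iff_gcd_eq_1)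
    then obtain p where p: "prime p" "p dvd gcd u v"
      using \<open>v \<noteq> 0\<close> by (metis gcd_eq_0_iff prime_divisorE)
    then have pu: "p dvd u" and pv: "p dvd v" by auto
    have "p dvd u\<^sup>2 - b * y * u * v + a * c * y\<^sup>2 * v\<^sup>2"
      using pu pv by (intro dvd_add dvd_diff) (auto simp: power2_eq_square)
    then have pN: "p dvd N" unfolding norm using p(1) prime_dvd_power by blast
    then have "p dvd u - T ^ (k - 1)" using N dvd_trans by blast
    from dvd_diff[OF pu this] have "p dvd T ^ (k - 1)" by simp
    then have "p dvd T" using p(1) prime_dvd_power by blast
    then have "p dvd T * T - 4 * N" using pN by simp
    moreover have "T * T - 4 * N = y\<^sup>2 * (b\<^sup>2 - 4 * (a * c))"
      unfolding T_def N_def by (simp add: power2_eq_square algebra_simps)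
    ultimately have "p dvd y\<^sup>2 * (b\<^sup>2 - 4 * (a * c))" by simp
    then have "p dvd y"
      using p(1) D by (metis dvd_trans prime_dvd_mult_iff prime_dvd_power)
    then show False using pv \<open>coprime v y\<close> p(1) by (meson coprime_common_divisor not_prime_unit)
  qed
  have "v dvd u\<^sup>2 - N ^ k"
  proof -
    have "u\<^sup>2 - N ^ k = v * (b * y * u - a * c * y\<^sup>2 * v)"
      unfolding norm[symmetric] by (simp add: power2_eq_square algebra_simps)
    then show ?thesis by simp
  qed
  then have "[u\<^sup>2 = N ^ k] (mod v)" by (simp add: cong_iff_dvd_diff)
  then obtain x where x: "[x ^ k = u] (mod v)"
    using exists_kth_root_mod \<open>odd k\<close> \<open>coprime u v\<close> by blast
  have cop: "coprime (a * y) v"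
    using \<open>coprime v y\<close> a by (metis coprime_commute coprime_divisors coprime_mult_left_iff dvd_refl)
  then obtain w where w: "[w = 1] (mod (a * y))" "[w = x] (mod v)"
    using binary_chinese_remainder_int by blast
  have "[w ^ k = u] (mod (a * y))"
  proof -
    have "[w ^ k = 1 ^ k] (mod (a * y))" by (intro cong_pow w)
    moreover have "a * y dvd u - 1" using u by (metis dvd_mult_left mult.assoc mult.commute)
    ultimately show ?thesis by (simp add: cong_iff_dvd_diff) (metis cong_iff_dvd_diff cong_sym cong_trans)
  qed
  moreover have "[w ^ k = u] (mod v)" using cong_pow[OF w(2), of k] x cong_trans by blast
  ultimately have "[w ^ k = u] (mod (a * y * v))" using cop by (rule coprime_cong_mult)
  then have "a * y * v dvd w ^ k - u" by (simp add: cong_iff_dvd_diff)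
  then show ?thesis using pow norm \<open>v \<noteq> 0\<close> unfolding N_def by blast
qed

subsection \<open>Quadratic polynomials\<close>

text \<open>Irreducibles of Z[t] are prime, so \<open>h\<close> divides some \<open>P i\<close>. The
  scalar \<open>s\<close> admits factorizations known only for a constant multiple of
  \<open>p\<close>.\<close>

lemma degree_factor_prod_le:
  fixes h p :: "int poly"
  assumes "irreducible h" "h dvd p" "smult s p = (\<Prod>i\<in>I. P i)" "finite I"
    and "\<And>i. i \<in> I \<Longrightarrow> P i \<noteq> 0" "\<And>i. i \<in> I \<Longrightarrow> degree (P i) \<le> B"
  shows "degree h \<le> B"
proof -
  have "prime_elem h" using assms(1) by (rule irreducible_imp_prime_elem)
  moreover have "h dvd prod_mset (image_mset P (mset_set I))"
    using assms(2,3) by (metis dvd_smult prod_unfold_prod_mset)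
  ultimately obtain i where "i \<in> I" "h dvd P i"
    using assms(4) by (elim prime_elem_dvd_prod_msetE) auto
  then show ?thesis using assms(5,6) dvd_imp_degree_le le_trans by metis
qed

text \<open>Turns a bound on irreducible factors into an explicit factorization; the unit joins the
  list as a factor of degree 0.\<close>

lemma exists_factorization_degree_le:
  fixes p :: "int poly"
  assumes "p \<noteq> 0" and "\<And>h. irreducible h \<Longrightarrow> h dvd p \<Longrightarrow> degree h \<le> B"
  shows "\<exists>hs. p = prod_list hs \<and> (\<forall>h\<in>set hs. degree h \<le> B)"
proof -
  obtain A where A: "\<And>h. h \<in># A \<Longrightarrow> prime h" "normalize (prod_mset A) = normalize p"
    using prime_factorization_exists'[OF assms(1)] by blast
  obtain e where e: "is_unit e" "p = e * prod_mset A"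
    using A(2) by (metis associatedE1 mult.commute)
  obtain hs where hs: "mset hs = A" using ex_mset by blast
  have "degree h \<le> B" if "h \<in> set hs" for h
  proof -
    have hA: "h \<in># A" using that hs by auto
    then have "h dvd p" unfolding e(2) by (intro dvd_mult dvd_prod_mset)
    then show ?thesis
      using assms(2)[OF prime_elem_imp_irreducible[OF prime_imp_prime_elem[OF A(1)[OF hA]]]] by simp
  qed
  moreover have "degree e = 0" using e(1) by (auto simp: is_unit_poly_iff)
  moreover have "p = prod_list (e # hs)" using e(2) by (simp add: prod_mset_prod_list flip: hs)
  ultimately show ?thesis by (intro exI[of _ "e # hs"]) auto
qed

lemma degree_add_const: "degree (p + [:c:]) = degree p"
proof (cases "degree p = 0")
  case True
  then show ?thesis by (auto elim!: degree_eq_zeroE)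
next
  case False
  then show ?thesis by (intro degree_add_eq_left) simp
qed

lemma pcompose_monom:
  fixes p :: "'a::comm_ring_1 poly"
  shows "pcompose (monom c n) p = smult c (p ^ n)"
  by (induction n) (simp_all add: monom_0 monom_Suc pcompose_pCons)

text \<open>Completing the square gives \<open>4 a f(g) = (2 a g + b)^2\<close>, so it is enough
  that \<open>2 a g + b\<close> is a constant times the \<open>k\<close>-th power of a linear
  polynomial.\<close>

lemma square_quadratic_exists_factorable:
  fixes f :: "int poly" and k :: nat
  assumes f: "f = [:c, b, a:]" and a: "a \<noteq> 0" and D: "b\<^sup>2 - 4 * (a * c) = 0" and k: "k > 0"
  shows "\<exists>g. degree g = k \<and> (\<forall>h. irreducible h \<and> h dvd pcompose f g \<longrightarrow> degree h \<le> 1)"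
proof -
  obtain g s L where g: "smult (2 * a) g + [:b:] = smult s (L ^ k)" "degree g = k"
    and s: "s \<noteq> 0" and L: "degree (L :: int poly) = 1"
  proof (cases "b = 0")
    case True
    show ?thesis
    proof (rule that[of "monom 1 k" "2 * a" "[:0, 1:]"])
      show "smult (2 * a) (monom 1 k) + [:b:] = smult (2 * a) ([:0, 1:] ^ k)"
        using True by (simp add: monom_altdef)
    qed (simp_all add: a degree_monom_eq)
  next
    case False
    \<comment> \<open>Since \<open>L\<close> is 1 modulo \<open>2 * a\<close>, so is
      \<open>L ^ k\<close>, and \<open>b * (L ^ k - 1)\<close> is divisible by \<open>2 * a\<close>.
      For \<open>b = 0\<close> this would give \<open>g = 0\<close>, hence the separate
      case.\<close>
    define L where "L = [:1, 2 * a:]"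
    have "L - 1 dvd L ^ k - 1 ^ k" by (metis dvd_triv_left power_diff_sumr2)
    then obtain r where r: "L ^ k - 1 = (L - 1) * r" by auto
    have "L - 1 = smult (2 * a) [:0, 1:]" by (simp add: L_def one_pCons)
    then have Lk: "L ^ k = 1 + smult (2 * a) ([:0, 1:] * r)" using r by (simp add: algebra_simps)
    have L1: "degree L = 1" "L \<noteq> 0" using a by (simp_all add: L_def)
    show ?thesis
    proof (rule that[of "smult b ([:0, 1:] * r)" b L])
      show eq: "smult (2 * a) (smult b ([:0, 1:] * r)) + [:b:] = smult b (L ^ k)"
        unfolding Lk by (simp add: smult_add_right mult.commute)
      have "degree (smult b (L ^ k)) = k" using False L1 by (simp add: degree_power_eq)
      then have "degree (smult (2 * a) (smult b ([:0, 1:] * r)) + [:b:]) = k" by (simp only: eq)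
      then have "degree (smult (2 * a) (smult b ([:0, 1:] * r))) = k"
        by (simp only: degree_add_const)
      moreover have "degree (smult (2 * a) p) = degree p" for p using a by simp
      ultimately show "degree (smult b ([:0, 1:] * r)) = k" by (simp only:)
    qed (use False L1 in auto)
  qed
  have "smult (4 * a) (pcompose f g) = smult (4 * a) ([:c:] + g * ([:b:] + g * [:a:]))"
    by (simp add: f pcompose_pCons)
  also have "\<dots> = (smult (2 * a) g + [:b:])\<^sup>2 - [:b\<^sup>2 - 4 * (a * c):]"
  proof -
    have *: "(smult (2 * a) g + [:b:])\<^sup>2
        = smult (4 * a * a) (g * g) + (smult (2 * a * b) g + smult (2 * a * b) g) + [:b\<^sup>2:]"
      by (simp add: power2_eq_square algebra_simps)
    have "[:c:] + g * ([:b:] + g * [:a:]) = [:c:] + smult b g + smult a (g * g)"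
      by (simp add: algebra_simps)
    then show ?thesis unfolding * smult_add_left[symmetric]
      by (intro poly_eqI) (simp add: coeff_pCons algebra_simps split: nat.splits)
  qed
  also have "\<dots> = smult (s * s) (\<Prod>i<2 * k. L)"
    unfolding g(1) D by (simp add: power2_eq_square flip: power_add mult_2)
  finally have eq: "smult (4 * a) (pcompose f g) = smult (s * s) (\<Prod>i<2 * k. L)" .
  \<comment> \<open>The constant \<open>s * s\<close> is stored as the extra factor with index
    \<open>2 * k\<close>.\<close>
  have "degree h \<le> 1" if h: "irreducible h" "h dvd pcompose f g" for h
  proof (rule degree_factor_prod_le[OF h(1), where s = 1 and I = "{..2 * k}" and
        P = "\<lambda>i. if i < 2 * k then L else [:s * s:]"])
    show "h dvd smult (s * s) (\<Prod>i<2 * k. L)" using h(2) unfolding eq[symmetric] by (rule dvd_smult)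
    show "smult 1 (smult (s * s) (\<Prod>i<2 * k. L)) = (\<Prod>i\<le>2 * k. if i < 2 * k then L else [:s * s:])"
      by (simp flip: lessThan_Suc_atMost)
  qed (use s L in auto)
  with g(2) show ?thesis by blast
qed

lemma nonsquare_quadratic_exists_factorable:
  fixes f :: "int poly" and k :: nat
  assumes f: "f = [:c, b, a:]" and a: "a \<noteq> 0" and D: "b\<^sup>2 - 4 * (a * c) \<noteq> 0"
    and k: "k > 0" "coprime (int k) (2 * a * (b\<^sup>2 - 4 * (a * c)))"
  shows "\<exists>g. degree g = k \<and> (\<forall>h. irreducible h \<and> h dvd pcompose f g \<longrightarrow> degree h \<le> 2 * totient k)"
proof -
  \<comment> \<open>The factor \<open>a\<close> serves integrality modulo \<open>a * y\<close>, the
    discriminant the coprimality of \<open>u\<close> and \<open>v\<close>, and the 2 forces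
    \<open>k\<close> to be odd.\<close>
  define y where "y = 2 * a * (b\<^sup>2 - 4 * (a * c))"
  have y: "even y" "y \<noteq> 0" "a dvd y" "b\<^sup>2 - 4 * (a * c) dvd y"
    using a D by (simp_all add: y_def)
  obtain u v w0 where
    pow: "\<And>\<rho>::complex. \<rho>\<^sup>2 + of_int b * \<rho> + of_int (a * c) = 0 \<Longrightarrow>
            (1 + of_int y * \<rho>) ^ k = of_int u + of_int (y * v) * \<rho>"
    and norm: "u\<^sup>2 - b * y * u * v + a * c * y\<^sup>2 * v\<^sup>2 = (1 - b * y + a * c * y\<^sup>2) ^ k"
    and v: "v \<noteq> 0" and w0: "a * y * v dvd w0 ^ k - u"
    using integral_power_representation[OF y(4,3,1) k(2)[folded y_def] k(1)] by metis
  define r where "r = csqrt (of_int (b\<^sup>2 - 4 * (a * c)))"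
  define \<rho> \<rho>' where "\<rho> = (- of_int b + r) / 2" and "\<rho>' = (- of_int b - r) / 2"
  have sum: "\<rho> + \<rho>' = - of_int b" by (simp add: \<rho>_def \<rho>'_def field_simps)
  have "4 * (\<rho> * \<rho>') = (- of_int b + r) * (- of_int b - r)" by (simp add: \<rho>_def \<rho>'_def)
  also have "\<dots> = of_int b ^ 2 - r ^ 2" by (simp add: power2_eq_square algebra_simps)
  also have "\<dots> = 4 * of_int (a * c)" unfolding r_def by (simp only: power2_csqrt) simp
  finally have prod: "\<rho> * \<rho>' = of_int (a * c)" by simp
  have root: "\<rho>\<^sup>2 + of_int b * \<rho> + of_int (a * c) = 0" "\<rho>'\<^sup>2 + of_int b * \<rho>' + of_int (a * c) = 0"
  proof -
    have b: "of_int b = - (\<rho> + \<rho>')" using sum by simp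
    show "\<rho>\<^sup>2 + of_int b * \<rho> + of_int (a * c) = 0" "\<rho>'\<^sup>2 + of_int b * \<rho>' + of_int (a * c) = 0"
      unfolding b prod[symmetric] by (simp_all add: power2_eq_square algebra_simps)
  qed
  \<comment> \<open>\<open>S\<close> is the trace of \<open>\<beta> ^ k\<close> and \<open>N\<close>
    the norm of \<open>\<beta>\<close>.\<close>
  define S N where "S = 2 * u - b * y * v" and "N = 1 - b * y + a * c * y\<^sup>2"
  have T: "(1 + of_int y * \<rho>) + (1 + of_int y * \<rho>') = of_int (2 - b * y)"
  proof -
    have "(1 + of_int y * \<rho>) + (1 + of_int y * \<rho>') = 2 + of_int y * (\<rho> + \<rho>')" by (simp add: algebra_simps)
    then show ?thesis unfolding sum by simp
  qed
  have N: "(1 + of_int y * \<rho>) * (1 + of_int y * \<rho>') = of_int N"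
  proof -
    have "(1 + of_int y * \<rho>) * (1 + of_int y * \<rho>') = 1 + of_int y * (\<rho> + \<rho>') + (of_int y)\<^sup>2 * (\<rho> * \<rho>')"
      by (simp add: algebra_simps power2_eq_square)
    then show ?thesis unfolding sum prod N_def by (simp add: mult_ac)
  qed
  have S: "(1 + of_int y * \<rho>) ^ k + (1 + of_int y * \<rho>') ^ k = of_int S"
  proof -
    have "(1 + of_int y * \<rho>) ^ k + (1 + of_int y * \<rho>') ^ k = 2 * of_int u + of_int (y * v) * (\<rho> + \<rho>')"
      unfolding pow[OF root(1)] pow[OF root(2)] by (simp add: algebra_simps)
    then show ?thesis unfolding sum S_def by (simp add: mult_ac)
  qed
  obtain \<Psi> where \<Psi>: "monom 1 (2 * k) - monom S k + [:N ^ k:] = (\<Prod>d | d dvd k. \<Psi> d)"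
    and deg: "\<And>d. d dvd k \<Longrightarrow> \<Psi> d \<noteq> 0 \<and> degree (\<Psi> d) = 2 * totient d"
    using twisted_cyclotomic_factorization[OF T N S k(1)] by blast
  define m where "m = a * y * v"
  have m: "m \<noteq> 0" using a y(2) v by (simp add: m_def)
  \<comment> \<open>With leading coefficient \<open>m\<close>, \<open>w\<close> is the constant
    \<open>w0\<close> modulo \<open>m\<close>, so \<open>m\<close> divides \<open>w ^ k - u\<close>
    in Z[t].\<close>
  define w where "w = [:w0, m:]"
  have w1: "degree w = 1" "w \<noteq> 0" using m by (simp_all add: w_def)
  obtain g where g: "w ^ k = [:u:] + smult m g"
  proof -
    have "w - [:w0:] dvd w ^ k - [:w0:] ^ k" by (metis dvd_triv_left power_diff_sumr2)
    moreover have "[:m:] dvd w - [:w0:]" by (intro dvdI[of _ _ "[:0, 1:]"]) (simp add: w_def)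
    ultimately have "[:m:] dvd w ^ k - [:w0 ^ k:]"
      by (metis dvd_trans poly_const_pow)
    moreover have "[:m:] dvd [:w0 ^ k - u:]"
      using w0 unfolding m_def[symmetric] by simp
    ultimately have "[:m:] dvd (w ^ k - [:w0 ^ k:]) + [:w0 ^ k - u:]" by (rule dvd_add)
    also have "(w ^ k - [:w0 ^ k:]) + [:w0 ^ k - u:] = w ^ k - [:u:]" by simp
    finally obtain g where "w ^ k - [:u:] = [:m:] * g" by (elim dvdE)
    then show ?thesis by (intro that[of g]) (simp add: algebra_simps)
  qed
  have "degree g = k"
  proof -
    have "degree (w ^ k) = k" using w1 by (simp add: degree_power_eq)
    then have "degree (smult m g) = k" unfolding g by (simp only: add.commute[of "[:u:]"] degree_add_const)
    then show ?thesis using m by simp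
  qed
  \<comment> \<open>In terms of \<open>w ^ k = u + m * g\<close> the left side is the quadratic with
    roots \<open>\<beta> ^ k\<close> and \<open>\<beta>' ^ k\<close>, which is the factored
    polynomial composed with \<open>w\<close>.\<close>
  have eq: "smult (a * y\<^sup>2 * v\<^sup>2) (pcompose f g) = (\<Prod>d | d dvd k. pcompose (\<Psi> d) w)"
  proof -
    have "smult (a * y\<^sup>2 * v\<^sup>2) (pcompose f g) = smult (a * y\<^sup>2 * v\<^sup>2) ([:c:] + g * ([:b:] + g * [:a:]))"
      by (simp add: f pcompose_pCons)
    also have "\<dots> = (smult m g)\<^sup>2 + smult (b * y * v) (smult m g) + [:a * c * y\<^sup>2 * v\<^sup>2:]"
      by (simp add: m_def power2_eq_square algebra_simps smult_add_right)
    also have "smult m g = w ^ k - [:u:]" using g by simp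
    also have "(w ^ k - [:u:])\<^sup>2 + smult (b * y * v) (w ^ k - [:u:]) + [:a * c * y\<^sup>2 * v\<^sup>2:]
        = (w ^ k)\<^sup>2 - smult S (w ^ k) + [:u\<^sup>2 - b * y * u * v + a * c * y\<^sup>2 * v\<^sup>2:]"
    proof -
      have *: "(w ^ k - [:u:])\<^sup>2 = (w ^ k)\<^sup>2 - (smult u (w ^ k) + smult u (w ^ k)) + [:u\<^sup>2:]"
        by (simp add: power2_eq_square algebra_simps)
      show ?thesis unfolding * smult_add_left[symmetric]
        by (intro poly_eqI) (simp add: S_def coeff_pCons algebra_simps split: nat.splits)
    qed
    also have "\<dots> = pcompose (monom 1 (2 * k) - monom S k + [:N ^ k:]) w"
      unfolding norm N_def[symmetric]
      by (simp add: pcompose_add pcompose_diff pcompose_monom mult.commute flip: power_mult)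
    also have "\<dots> = (\<Prod>d | d dvd k. pcompose (\<Psi> d) w)" unfolding \<Psi> by (rule pcompose_prod)
    finally show ?thesis .
  qed
  have "degree h \<le> 2 * totient k" if h: "irreducible h" "h dvd pcompose f g" for h
  proof (rule degree_factor_prod_le[OF h eq])
    show "finite {d. d dvd k}" using k by simp
    fix d assume "d \<in> {d. d dvd k}"
    then have d: "d dvd k" by simp
    show "pcompose (\<Psi> d) w \<noteq> 0" using deg[OF d] w1 by (simp add: pcompose_eq_0_iff)
    show "degree (pcompose (\<Psi> d) w) \<le> 2 * totient k"
      using deg[OF d] w1 totient_dvd_mono[OF d k(1)] by (simp add: degree_pcompose)
  qed
  with \<open>degree g = k\<close> show ?thesis by blast
qed

text \<open>Merges the two discriminant cases. The modulus \<open>M\<close> is even in both, so that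
  degrees prime to it are odd.\<close>

lemma quadratic_exists_factorable:
  fixes f :: "int poly"
  assumes "degree f = 2"
  shows "\<exists>M>0. even M \<and> (\<forall>k>0. coprime k M \<longrightarrow>
           (\<exists>g. degree g = k \<and> (\<forall>h. irreducible h \<and> h dvd pcompose f g \<longrightarrow> degree h \<le> 2 * totient k)))"
proof -
  define a b c where "a = coeff f 2" and "b = coeff f 1" and "c = coeff f 0"
  have f: "f = [:c, b, a:]"
    by (rule poly_eqI) (use assms in \<open>auto simp: a_def b_def c_def coeff_pCons numeral_2_eq_2 coeff_eq_0 split: nat.splits\<close>)
  have a: "a \<noteq> 0" using assms unfolding a_def by (metis degree_0 leading_coeff_0_iff zero_neq_numeral)
  show ?thesis
  proof (cases "b\<^sup>2 - 4 * (a * c) = 0")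
    case True
    have "\<exists>g. degree g = k \<and> (\<forall>h. irreducible h \<and> h dvd pcompose f g \<longrightarrow> degree h \<le> 2 * totient k)"
      if k: "k > 0" for k
    proof -
      have "1 \<le> 2 * totient k" using k by (simp add: Suc_le_eq)
      obtain g where g: "degree g = k" "\<And>h. irreducible h \<Longrightarrow> h dvd pcompose f g \<Longrightarrow> degree h \<le> 1"
        using square_quadratic_exists_factorable[OF f a True k] by blast
      show ?thesis using g(1) le_trans[OF g(2) \<open>1 \<le> 2 * totient k\<close>] by blast
    qed
    then show ?thesis by (intro exI[of _ 2]) simp
  next
    case False
    define y where "y = 2 * a * (b\<^sup>2 - 4 * (a * c))"
    have "coprime (int k) y" if "coprime k (nat \<bar>y\<bar>)" for k
      using that by (metis coprime_abs_right_iff coprime_int_iff int_nat_eq abs_ge_zero)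
    moreover have "nat \<bar>y\<bar> > 0" "even (nat \<bar>y\<bar>)"
      using a False by (simp_all add: y_def even_nat_iff)
    ultimately show ?thesis
      using nonsquare_quadratic_exists_factorable[OF f a False, folded y_def]
      by (intro exI[of _ "nat \<bar>y\<bar>"]) blast
  qed
qed

section \<open>Choice of the degree and conclusion\<close>

lemma ln_ln_geI:
  assumes "exp (exp X) \<le> (x::real)"
  shows "X \<le> ln (ln x)"
proof -
  have "0 < x" using assms exp_gt_zero[of "exp X"] by linarith
  then have "exp X \<le> ln x" using assms by (simp add: ln_ge_iff)
  moreover from this have "0 < ln x" using exp_gt_zero[of X] by linarith
  ultimately show ?thesis by (simp add: ln_ge_iff)
qed

theorem theorem1p1:
  fixes f :: "int poly"
  assumes "degree f = 2"
  shows "(\<exists>c::real. c > 0 \<and>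
            (\<forall>N::nat. \<exists>g::int poly. N \<le> degree g \<and> odd (degree g) \<and>
               (\<exists>hs::int poly list. pcompose f g = prod_list hs \<and>
                  (\<forall>h\<in>set hs. real (degree h)
                      \<le> c * real (degree g) / sqrt (ln (ln (real (degree g))))))))
         \<and> (\<forall>\<epsilon>::real. \<epsilon> > 0 \<longrightarrow> admits_polysmoothness f \<epsilon>)"
proof -
  obtain M :: nat where M: "M > 0" "even M"
    and fac: "\<And>k. k > 0 \<Longrightarrow> coprime k M \<Longrightarrow>
      \<exists>g. degree g = k \<and> (\<forall>h. irreducible h \<and> h dvd pcompose f g \<longrightarrow> degree h \<le> 2 * totient k)"
    using quadratic_exists_factorable[OF assms] by blast
  obtain C where C: "C > 0"
    and tot: "\<And>N. \<exists>k\<ge>N. coprime k M \<and> real (totient k) \<le> C * real k / ln (ln (real k))"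
    using totient_small_coprime[OF M(1)] by blast
  \<comment> \<open>Both claims follow from this: \<open>X = 1\<close> for the factorization,
    \<open>X = C / \<epsilon>\<close> for polysmoothness.\<close>
  have main: "\<exists>g::int poly. N \<le> degree g \<and> degree g > 0 \<and> odd (degree g) \<and> X \<le> ln (ln (real (degree g))) \<and>
      (\<forall>h. irreducible h \<and> h dvd pcompose f g \<longrightarrow> degree h \<le> 2 * totient (degree g)) \<and>
      real (2 * totient (degree g)) \<le> 2 * C * real (degree g) / ln (ln (real (degree g)))" for N X
  proof -
    obtain k where k: "k \<ge> N + 1 + nat \<lceil>exp (exp X)\<rceil>" "coprime k M"
      "real (totient k) \<le> C * real k / ln (ln (real k))" using tot by blast
    obtain g where g: "degree g = k"
      "\<And>h. irreducible h \<Longrightarrow> h dvd pcompose f g \<Longrightarrow> degree h \<le> 2 * totient k"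
      using fac[OF _ k(2)] k(1) by auto
    have "odd k" using k(2) M(2) by (metis coprime_common_divisor odd_one)
    moreover have "X \<le> ln (ln (real k))"
    proof (rule ln_ln_geI)
      show "exp (exp X) \<le> real k" using k(1) by linarith
    qed
    ultimately show ?thesis using k g by (intro exI[of _ g]) auto
  qed
  have "\<exists>g::int poly. N \<le> degree g \<and> odd (degree g) \<and>
          (\<exists>hs::int poly list. pcompose f g = prod_list hs \<and>
             (\<forall>h\<in>set hs. real (degree h) \<le> 2 * C * real (degree g) / sqrt (ln (ln (real (degree g))))))" for N
  proof -
    obtain g :: "int poly" where g: "N \<le> degree g" "degree g > 0" "odd (degree g)"
        "1 \<le> ln (ln (real (degree g)))"
      and h: "\<And>h. irreducible h \<Longrightarrow> h dvd pcompose f g \<Longrightarrow> degree h \<le> 2 * totient (degree g)"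
      and le: "real (2 * totient (degree g)) \<le> 2 * C * real (degree g) / ln (ln (real (degree g)))"
      using main[of N 1] by blast
    have "pcompose f g \<noteq> 0" using assms g(2) by (metis degree_0 degree_pcompose mult_eq_0_iff not_gr_zero zero_neq_numeral)
    then obtain hs where hs: "pcompose f g = prod_list hs" "\<And>h. h \<in> set hs \<Longrightarrow> degree h \<le> 2 * totient (degree g)"
      using exists_factorization_degree_le[OF _ h] by blast
    have "real (degree h) \<le> 2 * C * real (degree g) / sqrt (ln (ln (real (degree g))))" if "h \<in> set hs" for h
    proof -
      let ?l = "ln (ln (real (degree g)))"
      \<comment> \<open>As \<open>?l \<ge> 1\<close>, the bound with \<open>?l\<close> in the
        denominator is stronger than the one with \<open>sqrt ?l\<close>.\<close>
      have "sqrt ?l * 1 \<le> sqrt ?l * sqrt ?l" using g(4) by (intro mult_left_mono) auto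
      then have "sqrt ?l \<le> ?l" using g(4) by simp
      then have "2 * C * real (degree g) / ?l \<le> 2 * C * real (degree g) / sqrt ?l"
        using g(4) C by (intro divide_left_mono) auto
      moreover have "real (degree h) \<le> real (2 * totient (degree g))" using hs(2)[OF that] by (rule of_nat_mono)
      ultimately show ?thesis using le by linarith
    qed
    then show ?thesis using g hs(1) by blast
  qed
  moreover have "admits_polysmoothness f \<epsilon>" if "\<epsilon> > 0" for \<epsilon>
  proof -
    have X: "C / \<epsilon> > 0" using C that by simp
    obtain g :: "int poly" where g: "degree g > 0" "C / \<epsilon> \<le> ln (ln (real (degree g)))"
      and h: "\<And>h. irreducible h \<Longrightarrow> h dvd pcompose f g \<Longrightarrow> degree h \<le> 2 * totient (degree g)"
      and le: "real (2 * totient (degree g)) \<le> 2 * C * real (degree g) / ln (ln (real (degree g)))"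
      using main[of 0 "C / \<epsilon>"] by blast
    have "0 < ln (ln (real (degree g)))" using X g(2) by linarith
    \<comment> \<open>The threshold \<open>C / \<epsilon>\<close> turns the bound into
      \<open>2 * \<epsilon> * degree g\<close>, and 2 is the degree of \<open>f\<close>.\<close>
    then have "2 * C * real (degree g) / ln (ln (real (degree g))) \<le> 2 * C * real (degree g) / (C / \<epsilon>)"
      using X C by (intro divide_left_mono[OF g(2)] mult_pos_pos) simp_all
    also have "\<dots> = \<epsilon> * real (degree f) * real (degree g)" using C assms by simp
    finally have *: "real (2 * totient (degree g)) \<le> \<epsilon> * real (degree f) * real (degree g)" using le by linarith
    have "real (degree h) \<le> \<epsilon> * real (degree f) * real (degree g)"
      if "irreducible h" "h dvd pcompose f g" for h
      using of_nat_mono[OF h[OF that], where 'a = real] * by linarith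
    then show ?thesis unfolding admits_polysmoothness_def using g(1) by blast
  qed
  moreover have "2 * C > 0" using C by simp
  ultimately show ?thesis by blast
qed

end
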